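(* Let $\mathcal{A}$ be a sixth order three dimensional quasi-truncated Hankel tensor with generating vector $\mathbf{v} = (v_0, v_1, 0,0,0,0, v_6, 0,0,0,0, v_{11}, v_{12})^\top \in \mathbb{R}^{13}$, and suppose that $v_0, v_6, v_{12} \ge 0$. If $\mathcal{A}$ is PSD, then the inequalities $$|v_1| \le \left(\frac{v_0}{5}\right)^{5/6} v_6^{1/6}, \qquad |v_{11}| \le \left(\frac{v_{12}}{5}\right)^{5/6} v_6^{1/6}, \qquad \sqrt{v_0 v_{12}} \ge 10\, v_6$$ hold. If furthermore $$v_1 v_{12}^{5/6} = v_{11} v_0^{5/6},$$ then also $$\sqrt{v_0 v_{12}} \ge (560 + 70\sqrt{70})\, v_6.$$
   Context: The sixth order three dimensional Hankel tensor with generating vector $\mathbf{v}=(v_0,\ldots,v_{12})^\top$ is the real symmetric tensor $\mathcal{A}=(a_{i_1\cdots i_6})$ with $a_{i_1\cdots i_6}=v_{i_1+\cdots+i_6-6}$ for $i_1,\ldots,i_6\in\{1,2,3\}$; it is called quasi-truncated if all entries of $\mathbf{v}$ other than $v_0,v_1,v_6,v_{11},v_{12}$ are zero. The tensor $\mathcal{A}$ is PSD (positive semi-definite) if $f(\mathbf{x})=\sum_{i_1,\ldots,i_6=1}^3 a_{i_1\cdots i_6}x_{i_1}\cdots x_{i_6}\ge 0$ for all $\mathbf{x}\in\mathbb{R}^3$. *)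

theory Defs
  imports Complex_Main
begin

text \<open>A real tensor of order \<open>m\<close> and dimension \<open>n\<close> is given by its entries at the
  multi-indices \<open>[i\<^sub>1, \<dots>, i\<^sub>m]\<close> with \<open>1 \<le> i\<^sub>k \<le> n\<close>; values at other lists are irrelevant.\<close>

type_synonym tensor = "nat list \<Rightarrow> real"

definition multi_indices :: "nat \<Rightarrow> nat \<Rightarrow> nat list set" where
  "multi_indices m n = {is. length is = m \<and> set is \<subseteq> {1..n}}"

text \<open>A vector of \<open>\<real>\<^sup>n\<close> is given by its coordinates \<open>x 1, \<dots>, x n\<close>; no other values of \<open>x\<close>
  enter the form.\<close>

definition tensor_form :: "nat \<Rightarrow> nat \<Rightarrow> tensor \<Rightarrow> (nat \<Rightarrow> real) \<Rightarrow> real" where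
  "tensor_form m n A x = (\<Sum>is\<in>multi_indices m n. A is * (\<Prod>i\<leftarrow>is. x i))"

definition tensor_psd :: "nat \<Rightarrow> nat \<Rightarrow> tensor \<Rightarrow> bool" where
  "tensor_psd m n A \<longleftrightarrow> (\<forall>x. 0 \<le> tensor_form m n A x)"

text \<open>The subtraction does not truncate, since every index is at least 1. The positions reached
  in \<open>v\<close> are exactly \<open>0, \<dots>, m * (n - 1)\<close>.\<close>

definition hankel_tensor :: "nat \<Rightarrow> nat \<Rightarrow> real list \<Rightarrow> tensor \<Rightarrow> bool" where
  "hankel_tensor m n v A \<longleftrightarrow>
     length v = m * (n - 1) + 1 \<and> (\<forall>is\<in>multi_indices m n. A is = v ! (sum_list is - m))"

definition quasi_truncated_hankel_tensor :: "real list \<Rightarrow> tensor \<Rightarrow> bool" where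
  "quasi_truncated_hankel_tensor v A \<longleftrightarrow>
     hankel_tensor 6 3 v A \<and> (\<forall>k<length v. k \<notin> {0, 1, 6, 11, 12} \<longrightarrow> v ! k = 0)"

end

theory Submission
  imports Defs "HOL-Computational_Algebra.Polynomial"
begin

text \<open>
  Collecting equal index sums, the form of a Hankel tensor is \<open>\<Sum>k. v\<^sub>k c\<^sub>k(x)\<close>, where
  \<open>c\<^sub>k(x)\<close> is the coefficient of \<open>t\<^sup>k\<close> in \<open>(x\<^sub>1 + x\<^sub>2 t + x\<^sub>3 t\<^sup>2)\<^sup>6\<close>
  (\<open>tensor_form_hankel\<close>). For a quasi-truncated tensor only five coefficients survive, and
  the form becomes an explicit sextic in \<open>x, y, z\<close> (\<open>tensor_form_quasi_truncated\<close>). Each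
  inequality comes from evaluating this sextic at a few points.

  \<^item> On \<open>z = 0\<close> and on \<open>x = 0\<close> it is a binary sextic \<open>a x\<^sup>6 + 6 b x\<^sup>5 y + c y\<^sup>6\<close>.
    The bound on \<open>b\<close> is the one for which the weighted AM-GM inequality makes the sextic
    nonnegative, and it is necessary because AM-GM is an equality where \<open>a x\<^sup>6 = 5 c y\<^sup>6\<close>.

  \<^item> On \<open>y = 0\<close> it is a quadratic form in the cubes \<open>x\<^sup>3\<close> and \<open>z\<^sup>3\<close>, which take all
    real values, so its discriminant gives the bound with the factor 10.

  \<^item> For \<open>v\<^sub>0, v\<^sub>1\<^sub>2 > 0\<close>, the balance condition says that the terms with \<open>v\<^sub>1\<close> and
    \<open>v\<^sub>1\<^sub>1\<close> cancel along \<open>v\<^sub>0\<^bsup>1/6\<^esup> x = - v\<^sub>1\<^sub>2\<^bsup>1/6\<^esup> z\<close>. With \<open>y\<^sup>2 = - u x z\<close> what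
    remains is, up to a positive factor,
    \<open>2 sqrt (v\<^sub>0 v\<^sub>1\<^sub>2) + v\<^sub>6 (u\<^sup>3 - 30 u\<^sup>2 + 90 u - 20)\<close>. The cubic has its minimum over
    \<open>u \<ge> 0\<close> at \<open>u = 10 + sqrt 70\<close>, with value \<open>- 2 (560 + 70 sqrt 70)\<close>. If instead
    \<open>v\<^sub>0 v\<^sub>1\<^sub>2 = 0\<close>, then \<open>v\<^sub>6 = 0\<close> by the bound with the factor 10.
\<close>

section \<open>The form of a Hankel tensor\<close>

lemma multi_indices_0: "multi_indices 0 n = {[]}"
  by (auto simp: multi_indices_def)

lemma multi_indices_Suc:
  "multi_indices (Suc m) n = (\<lambda>(i, is). i # is) ` ({1..n} \<times> multi_indices m n)"
  by (auto simp: multi_indices_def length_Suc_conv image_iff)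

text \<open>Distributing the product picks one summand from each of the \<open>m\<close> factors; a
  multi-index records the choice.\<close>

lemma sum_power_eq_sum_multi_indices:
  fixes f :: "nat \<Rightarrow> 'a::comm_semiring_1"
  shows "(\<Sum>i=1..n. f i) ^ m = (\<Sum>is\<in>multi_indices m n. \<Prod>i\<leftarrow>is. f i)"
proof (induction m)
  case 0
  then show ?case by (simp add: multi_indices_0)
next
  case (Suc m)
  have "inj_on (\<lambda>(i, is). i # is) ({1..n} \<times> multi_indices m n)"
    by (auto simp: inj_on_def)
  then have "(\<Sum>is\<in>multi_indices (Suc m) n. \<Prod>i\<leftarrow>is. f i)
      = (\<Sum>(i, is)\<in>{1..n} \<times> multi_indices m n. f i * (\<Prod>j\<leftarrow>is. f j))"
    by (simp add: multi_indices_Suc sum.reindex case_prod_unfold)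
  also have "\<dots> = (\<Sum>i=1..n. f i) * (\<Sum>is\<in>multi_indices m n. \<Prod>i\<leftarrow>is. f i)"
    by (simp add: sum_product sum.cartesian_product)
  finally show ?case by (simp only: power_Suc Suc.IH)
qed

lemma length_le_sum_list:
  fixes "is" :: "nat list"
  assumes "set is \<subseteq> {1..n}"
  shows "length is \<le> sum_list is"
  using assms by (induction "is") auto

lemma sum_list_le_length_mult:
  fixes "is" :: "nat list"
  assumes "set is \<subseteq> {1..n}"
  shows "sum_list is \<le> length is * n"
  using assms by (induction "is") auto

lemma prod_list_monom:
  fixes x :: "nat \<Rightarrow> 'a::comm_semiring_1"
  assumes "set is \<subseteq> {1..n}"
  shows "(\<Prod>i\<leftarrow>is. monom (x i) (i - 1)) = monom (\<Prod>i\<leftarrow>is. x i) (sum_list is - length is)"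
  using assms
proof (induction "is")
  case Nil
  then show ?case by simp
next
  case (Cons i "is")
  then have "length is \<le> sum_list is" "1 \<le> i"
    using length_le_sum_list[of "is" n] by auto
  then show ?case using Cons by (simp add: mult_monom)
qed

text \<open>Giving the variable \<open>x\<^sub>i\<close> the weight \<open>t\<^bsup>i-1\<^esup>\<close> makes the exponent of \<open>t\<close> record the
  position in \<open>v\<close> that a multi-index reaches. The coefficients of a power of one polynomial
  thus replace the sum over all \<open>n\<^sup>m\<close> multi-indices.\<close>

lemma tensor_form_hankel:
  assumes "hankel_tensor m n v A"
  shows "tensor_form m n A x
    = (\<Sum>k\<le>m * (n - 1). v ! k * coeff ((\<Sum>i=1..n. monom (x i) (i - 1)) ^ m) k)"
proof -
  let ?I = "multi_indices m n"
  have in_range: "sum_list is - m \<le> m * (n - 1)" if "is \<in> ?I" for "is"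
    using that sum_list_le_length_mult[of "is" n]
    by (auto simp: multi_indices_def diff_mult_distrib2)
  have coeff_power: "coeff ((\<Sum>i=1..n. monom (x i) (i - 1)) ^ m) k
      = (\<Sum>is\<in>?I. if sum_list is - m = k then \<Prod>i\<leftarrow>is. x i else 0)" for k
  proof -
    have "(\<Sum>i=1..n. monom (x i) (i - 1)) ^ m
        = (\<Sum>is\<in>?I. monom (\<Prod>i\<leftarrow>is. x i) (sum_list is - m))"
      unfolding sum_power_eq_sum_multi_indices
      by (rule sum.cong) (use prod_list_monom[of _ n x] in \<open>auto simp: multi_indices_def\<close>)
    then show ?thesis by (simp add: coeff_sum)
  qed
  have "tensor_form m n A x = (\<Sum>is\<in>?I. v ! (sum_list is - m) * (\<Prod>i\<leftarrow>is. x i))"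
    using assms by (simp add: tensor_form_def hankel_tensor_def)
  also have "\<dots> = (\<Sum>is\<in>?I. \<Sum>k\<le>m * (n - 1).
      v ! k * (if sum_list is - m = k then \<Prod>i\<leftarrow>is. x i else 0))"
    by (rule sum.cong) (use in_range in \<open>simp_all add: if_distrib cong: if_cong\<close>)
  also have "\<dots> = (\<Sum>k\<le>m * (n - 1). \<Sum>is\<in>?I.
      v ! k * (if sum_list is - m = k then \<Prod>i\<leftarrow>is. x i else 0))"
    by (rule sum.swap)
  finally show ?thesis by (simp only: coeff_power sum_distrib_left)
qed

lemma tensor_form_quasi_truncated:
  assumes "quasi_truncated_hankel_tensor [v0, v1, 0, 0, 0, 0, v6, 0, 0, 0, 0, v11, v12] A"
  shows "tensor_form 6 3 A x
    = v0 * x 1 ^ 6 + 6 * v1 * x 1 ^ 5 * x 2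
      + v6 * (x 2 ^ 6 + 30 * x 1 * x 2 ^ 4 * x 3 + 90 * x 1 ^ 2 * x 2 ^ 2 * x 3 ^ 2
              + 20 * x 1 ^ 3 * x 3 ^ 3)
      + 6 * v11 * x 2 * x 3 ^ 5 + v12 * x 3 ^ 6"
proof -
  define a b c where "a = x 1" and "b = x 2" and "c = x 3"
  have "{1..3::nat} = {1, 2, 3}" by auto
  then have p: "(\<Sum>i=1..3. monom (x i) (i - 1)) = [:a, b, c:]"
    by (simp add: a_def b_def c_def monom_altdef numeral_2_eq_2)
  \<comment> \<open>A product of explicit quartics, unlike a sixth power, is multiplied out by the rules
      for coefficient lists.\<close>
  have p6: "[:a, b, c:] ^ 6 = [:a, b, c:] ^ 2 * [:a, b, c:] ^ 2 * [:a, b, c:] ^ 2"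
    by (simp flip: power_add)
  have p2: "[:a, b, c:] ^ 2 = [:a\<^sup>2, 2*a*b, 2*a*c + b\<^sup>2, 2*b*c, c\<^sup>2:]"
    by (simp add: power2_eq_square algebra_simps)
  have set: "{..12::nat} = {0,1,2,3,4,5,6,7,8,9,10,11,12}"
    by (rule set_eqI) (simp, arith)
  have "hankel_tensor 6 3 [v0, v1, 0, 0, 0, 0, v6, 0, 0, 0, 0, v11, v12] A"
    using assms by (simp add: quasi_truncated_hankel_tensor_def)
  from tensor_form_hankel[OF this, of x, unfolded p p6 p2]
  show ?thesis
    unfolding a_def[symmetric] b_def[symmetric] c_def[symmetric]
    by (simp add: set coeff_pCons numeral_eq_Suc algebra_simps)
qed

section \<open>Bounds from nonnegative forms\<close>

text \<open>In terms of \<open>\<alpha> = (a/5)\<^bsup>1/6\<^esup>\<close> and \<open>\<gamma> = c\<^bsup>1/6\<^esup>\<close> the sextic is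
  \<open>5 (\<alpha>x)\<^sup>6 + 6 b x\<^sup>5 y + (\<gamma>y)\<^sup>6\<close>. The points \<open>(\<gamma>, \<plusminus>\<alpha>)\<close>, where \<open>|\<alpha>x| = |\<gamma>y|\<close>, are
  the equality case of AM-GM, and one of them makes the middle term nonpositive.\<close>

lemma abs_coeff_le_of_binary_sextic_nonneg_pos:
  fixes a b c :: real
  assumes "a > 0" "c > 0"
    and nonneg: "\<And>x y. 0 \<le> a * x ^ 6 + 6 * b * x ^ 5 * y + c * y ^ 6"
  shows "\<bar>b\<bar> \<le> (a / 5) powr (5/6) * c powr (1/6)"
proof -
  define \<alpha> \<gamma> where "\<alpha> = (a / 5) powr (1/6)" and "\<gamma> = c powr (1/6)"
  have pos: "\<alpha> > 0" "\<gamma> > 0" using assms by (auto simp: \<alpha>_def \<gamma>_def)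
  have a: "a = 5 * \<alpha> ^ 6" and \<alpha>5: "(a / 5) powr (5/6) = \<alpha> ^ 5" and c: "c = \<gamma> ^ 6"
    using assms by (simp_all add: \<alpha>_def \<gamma>_def powr_power)
  have "\<bar>b\<bar> * (\<alpha> * \<gamma> ^ 5) \<le> \<alpha> ^ 5 * \<gamma> * (\<alpha> * \<gamma> ^ 5)"
  proof (cases "b \<ge> 0")
    case True
    then show ?thesis using nonneg[of \<gamma> "- \<alpha>"]
      by (simp add: a c algebra_simps numeral_eq_Suc)
  next
    case False
    then show ?thesis using nonneg[of \<gamma> \<alpha>]
      by (simp add: a c algebra_simps numeral_eq_Suc)
  qed
  then have "\<bar>b\<bar> \<le> \<alpha> ^ 5 * \<gamma>"
    using pos by (simp only: mult_le_cancel_right_pos mult_pos_pos zero_less_power)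
  then show ?thesis by (simp only: \<alpha>5 \<gamma>_def)
qed

text \<open>If \<open>a\<close> or \<open>c\<close> vanishes, the sextic is zero at the test points above whatever
  \<open>b\<close> is. Raising both outer coefficients by \<open>\<epsilon>\<close> keeps the sextic
  nonnegative and the bound is continuous, so the limit \<open>\<epsilon> \<rightarrow> 0\<close> covers these cases.\<close>

lemma abs_coeff_le_of_binary_sextic_nonneg:
  fixes a b c :: real
  assumes "a \<ge> 0" "c \<ge> 0"
    and nonneg: "\<And>x y. 0 \<le> a * x ^ 6 + 6 * b * x ^ 5 * y + c * y ^ 6"
  shows "\<bar>b\<bar> \<le> (a / 5) powr (5/6) * c powr (1/6)"
proof (rule tendsto_lowerbound)
  show "((\<lambda>\<epsilon>. ((a + \<epsilon>) / 5) powr (5/6) * (c + \<epsilon>) powr (1/6))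
      \<longlongrightarrow> (a / 5) powr (5/6) * c powr (1/6)) (at_right 0)"
  proof (intro tendsto_mult tendsto_powr')
    show "((\<lambda>\<epsilon>. (a + \<epsilon>) / 5) \<longlongrightarrow> a / 5) (at_right 0)" 
      by (rule tendsto_eq_intros refl | simp)+
    show "((\<lambda>\<epsilon>. c + \<epsilon>) \<longlongrightarrow> c) (at_right 0)"
      by (rule tendsto_eq_intros refl | simp)+
  qed (use assms in \<open>auto simp: eventually_at_filter\<close>)
  show "\<forall>\<^sub>F \<epsilon> in at_right 0. \<bar>b\<bar> \<le> ((a + \<epsilon>) / 5) powr (5/6) * (c + \<epsilon>) powr (1/6)"
  proof (rule eventually_at_right_less[THEN eventually_mono])
    fix \<epsilon> :: real
    assume "0 < \<epsilon>"
    have "0 \<le> (a + \<epsilon>) * x ^ 6 + 6 * b * x ^ 5 * y + (c + \<epsilon>) * y ^ 6" for x y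
    proof -
      have "0 \<le> \<epsilon> * x ^ 6" "0 \<le> \<epsilon> * y ^ 6" using \<open>0 < \<epsilon>\<close> by simp_all
      with nonneg[of x y] show ?thesis unfolding distrib_right by linarith
    qed
    then show "\<bar>b\<bar> \<le> ((a + \<epsilon>) / 5) powr (5/6) * (c + \<epsilon>) powr (1/6)"
      using assms \<open>0 < \<epsilon>\<close> by (intro abs_coeff_le_of_binary_sextic_nonneg_pos) auto
  qed
qed simp

lemma abs_coeff_le_of_quadratic_nonneg:
  fixes a b c :: real
  assumes "a \<ge> 0" "c \<ge> 0"
    and nonneg: "\<And>p q. 0 \<le> a * p\<^sup>2 + 2 * b * p * q + c * q\<^sup>2"
  shows "\<bar>b\<bar> \<le> sqrt (a * c)"
proof (rule real_le_rsqrt)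
  consider "a > 0" | "c > 0" | "a = 0" "c = 0" using assms by linarith
  then show "\<bar>b\<bar>\<^sup>2 \<le> a * c"
  proof cases
    case 1
    have "0 \<le> a * (a * c - b\<^sup>2)"
      using nonneg[of "- b" a] by (simp add: power2_eq_square algebra_simps)
    with 1 show ?thesis by (simp add: zero_le_mult_iff)
  next
    case 2
    have "0 \<le> c * (a * c - b\<^sup>2)"
      using nonneg[of c "- b"] by (simp add: power2_eq_square algebra_simps)
    with 2 show ?thesis by (simp add: zero_le_mult_iff)
  next
    case 3
    with nonneg[of 1 1] nonneg[of 1 "-1"] show ?thesis by simp
  qed
qed

text \<open>The form is evaluated at \<open>(\<beta>, y, -\<alpha>)\<close> with \<open>\<alpha> = v\<^sub>0\<^bsup>1/6\<^esup>\<close>, \<open>\<beta> = v\<^sub>1\<^sub>2\<^bsup>1/6\<^esup>\<close>.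
  There the two outer sixth powers contribute equally and the balance condition cancels the terms
  of odd degree in \<open>y\<close>.\<close>

lemma middle_coeff_bound_of_balanced_sextic_nonneg:
  fixes v0 v1 v6 v11 v12 :: real
  assumes "v0 > 0" "v12 > 0"
    and nonneg: "\<And>x y z. 0 \<le> v0 * x ^ 6 + 6 * v1 * x ^ 5 * y
      + v6 * (y ^ 6 + 30 * x * y ^ 4 * z + 90 * x ^ 2 * y ^ 2 * z ^ 2 + 20 * x ^ 3 * z ^ 3)
      + 6 * v11 * y * z ^ 5 + v12 * z ^ 6"
    and balanced: "v1 * v12 powr (5/6) = v11 * v0 powr (5/6)"
  shows "(560 + 70 * sqrt 70) * v6 \<le> sqrt (v0 * v12)"
proof -
  define \<alpha> \<beta> s where "\<alpha> = v0 powr (1/6)" and "\<beta> = v12 powr (1/6)" and "s = \<alpha> * \<beta>"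
  have "s > 0" using assms by (simp add: s_def \<alpha>_def \<beta>_def)
  have v0: "v0 = \<alpha> ^ 6" and v12: "v12 = \<beta> ^ 6"
    and \<alpha>5: "v0 powr (5/6) = \<alpha> ^ 5" and \<beta>5: "v12 powr (5/6) = \<beta> ^ 5"
    using assms by (simp_all add: \<alpha>_def \<beta>_def powr_power)
  have "v0 * v12 = (s ^ 3)\<^sup>2"
    by (simp add: v0 v12 s_def power_mult_distrib flip: power_mult)
  then have sqrt: "sqrt (v0 * v12) = s ^ 3"
    using \<open>s > 0\<close> by (simp only: real_sqrt_abs abs_of_pos zero_less_power)
  \<comment> \<open>The larger critical point of \<open>u\<^sup>3 - 30 u\<^sup>2 + 90 u - 20\<close>, that is, the larger root of
      \<open>u\<^sup>2 - 20 u + 30\<close>.\<close>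
  define u where "u = 10 + sqrt 70"
  have "u\<^sup>2 = 20 * u - 30" by (simp add: u_def power2_eq_square algebra_simps)
  have "u > 0" by (simp add: u_def add_pos_nonneg)
  have cubic: "u ^ 3 - 30 * u\<^sup>2 + 90 * u - 20 = - 2 * (560 + 70 * sqrt 70)"
  proof -
    have "u ^ 3 = u * u\<^sup>2" by (simp add: power3_eq_cube power2_eq_square)
    also have "\<dots> = 20 * u\<^sup>2 - 30 * u"
      by (subst \<open>u\<^sup>2 = _\<close>) (simp add: power2_eq_square algebra_simps)
    finally show ?thesis using \<open>u\<^sup>2 = _\<close> by (simp add: u_def)
  qed
  define y where "y = sqrt (u * s)"
  have y2: "y\<^sup>2 = u * s" using \<open>u > 0\<close> \<open>s > 0\<close> by (simp add: y_def)
  have y4: "y ^ 4 = (u * s)\<^sup>2" and y6: "y ^ 6 = (u * s) ^ 3"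
    by (simp_all flip: y2 power_mult)
  have "0 \<le> \<alpha> ^ 6 * \<beta> ^ 6 + \<beta> ^ 6 * \<alpha> ^ 6 + 6 * y * (v1 * \<beta> ^ 5 - v11 * \<alpha> ^ 5)
      + v6 * (y ^ 6 - 30 * s * y ^ 4 + 90 * s\<^sup>2 * y\<^sup>2 - 20 * s ^ 3)"
    using nonneg[of \<beta> y "- \<alpha>"]
    by (simp add: v0 v12 s_def power_mult_distrib algebra_simps)
  also have "\<dots> = s ^ 3 * (2 * s ^ 3 + v6 * (u ^ 3 - 30 * u\<^sup>2 + 90 * u - 20))"
    using balanced unfolding y2 y4 y6 \<alpha>5 \<beta>5
    by (simp add: s_def power_mult_distrib algebra_simps numeral_eq_Suc)
  finally have "0 \<le> 2 * s ^ 3 + v6 * (u ^ 3 - 30 * u\<^sup>2 + 90 * u - 20)"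
    using \<open>s > 0\<close> by (simp add: zero_le_mult_iff)
  then show ?thesis unfolding cubic sqrt by (simp add: algebra_simps)
qed

section \<open>Necessary conditions for positive semidefiniteness\<close>

theorem proposition3:
  fixes A :: tensor and v0 v1 v6 v11 v12 :: real
  assumes "quasi_truncated_hankel_tensor [v0, v1, 0, 0, 0, 0, v6, 0, 0, 0, 0, v11, v12] A"
    and "v0 \<ge> 0" and "v6 \<ge> 0" and "v12 \<ge> 0"
    and "tensor_psd 6 3 A"
  shows "\<bar>v1\<bar> \<le> (v0 / 5) powr (5/6) * v6 powr (1/6)
       \<and> \<bar>v11\<bar> \<le> (v12 / 5) powr (5/6) * v6 powr (1/6)
       \<and> sqrt (v0 * v12) \<ge> 10 * v6
       \<and> (v1 * v12 powr (5/6) = v11 * v0 powr (5/6) \<longrightarrow>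
            sqrt (v0 * v12) \<ge> (560 + 70 * sqrt 70) * v6)"
proof -
  have nonneg: "0 \<le> v0 * x ^ 6 + 6 * v1 * x ^ 5 * y
      + v6 * (y ^ 6 + 30 * x * y ^ 4 * z + 90 * x ^ 2 * y ^ 2 * z ^ 2 + 20 * x ^ 3 * z ^ 3)
      + 6 * v11 * y * z ^ 5 + v12 * z ^ 6" for x y z
  proof -
    have "0 \<le> tensor_form 6 3 A ((\<lambda>_. 0)(1 := x, 2 := y, 3 := z))"
      using assms(5) by (simp add: tensor_psd_def)
    then show ?thesis unfolding tensor_form_quasi_truncated[OF assms(1)] by simp
  qed
  have v1: "\<bar>v1\<bar> \<le> (v0 / 5) powr (5/6) * v6 powr (1/6)"
  proof (rule abs_coeff_le_of_binary_sextic_nonneg)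
    show "0 \<le> v0 * x ^ 6 + 6 * v1 * x ^ 5 * y + v6 * y ^ 6" for x y
      using nonneg[of x y 0] by simp
  qed (use assms in auto)
  have v11: "\<bar>v11\<bar> \<le> (v12 / 5) powr (5/6) * v6 powr (1/6)"
  proof (rule abs_coeff_le_of_binary_sextic_nonneg)
    show "0 \<le> v12 * z ^ 6 + 6 * v11 * z ^ 5 * y + v6 * y ^ 6" for z y
      using nonneg[of 0 y z] by (simp add: algebra_simps)
  qed (use assms in auto)
  have "\<bar>10 * v6\<bar> \<le> sqrt (v0 * v12)"
  proof (rule abs_coeff_le_of_quadratic_nonneg)
    fix p q :: real
    have "root 3 r ^ 3 = r" "root 3 r ^ 6 = r\<^sup>2" for r :: real
    proof -
      show r: "root 3 r ^ 3 = r" by (simp add: odd_real_root_pow)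
      have "root 3 r ^ 6 = (root 3 r ^ 3)\<^sup>2" by (simp flip: power_mult)
      then show "root 3 r ^ 6 = r\<^sup>2" by (simp only: r)
    qed
    then show "0 \<le> v0 * p\<^sup>2 + 2 * (10 * v6) * p * q + v12 * q\<^sup>2"
      using nonneg[of "root 3 p" 0 "root 3 q"] by (simp add: algebra_simps)
  qed (use assms in auto)
  then have v6: "10 * v6 \<le> sqrt (v0 * v12)" using assms by simp
  have "(560 + 70 * sqrt 70) * v6 \<le> sqrt (v0 * v12)"
    if balanced: "v1 * v12 powr (5/6) = v11 * v0 powr (5/6)"
  proof (cases "v0 > 0 \<and> v12 > 0")
    case True
    then show ?thesis
      using middle_coeff_bound_of_balanced_sextic_nonneg nonneg balanced by blast
  next
    case False
    then have "v0 = 0 \<or> v12 = 0" using assms by auto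
    then have "v6 = 0" using v6 assms by auto
    then show ?thesis using assms by simp
  qed
  with v1 v11 v6 show ?thesis by blast
qed

end
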